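(* Every Banach space $X$ with property ( * ) is strongly $\mathcal{K}_{\sigma\delta}$.
   Context: Banach spaces are real. Property ( * ): for $\varepsilon\ge 0$, a bounded subset $M$ of a Banach space $X$ is $\varepsilon$-weakly relatively compact if $\overline{M}^{w^*}\subseteq X+\varepsilon B_{X^{**}}$ (closure in $(X^{**},w^* )$). $X$ has property ( * ) if there is a countable family $\{M_{n,p}: n,p\in\mathbb{N}\}$ of (convex and symmetric) subsets of $X$ such that each $M_{n,p}$ is $\frac1p$-weakly relatively compact, and for every $p\in\mathbb{N}$ and every weakly compact $L\subseteq X$ there is $n\in\mathbb{N}$ with $L\subseteq M_{n,p}$. A subset $A$ of a topological space $T$ is strongly $\mathcal{K}_{\sigma\delta}$ if there are compact subsets $K_{n,m}$ ($n,m\in\mathbb{N}$) of $T$ with $A=\bigcap_{n=1}^\infty\bigcup_{m=1}^\infty K_{n,m}$ and such that for each compact $L\subseteq A$ and each $n$ there is $m$ with $L\subseteq K_{n,m}$. A Banach space $X$ is called strongly $\mathcal{K}_{\sigma\delta}$ if $X$ is a strongly $\mathcal{K}_{\sigma\delta}$ subset of $(X^{**},w^* )$ (with $X$ canonically embedded in $X^{**}$). *)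

theory Defs
  imports "HOL-Analysis.Analysis"
begin

type_synonym 'a dual = "'a \<Rightarrow>\<^sub>L real"
type_synonym 'a bidual = "'a dual \<Rightarrow>\<^sub>L real"

text \<open>For scalar-valued maps the strong operator topology is pointwise convergence on the
  underlying space, i.e. the weak* topology of the dual.\<close>
definition weak_star :: "'b::real_normed_vector dual topology" where
  "weak_star = strong_operator_topology"

text \<open>The coarsest topology making all elements of the dual continuous; \<^term>\<open>euclidean\<close>
  on the function space is the product topology.\<close>
definition weak_topology :: "'a::real_normed_vector topology" where
  "weak_topology = pullback_topology UNIV (\<lambda>x (f :: 'a dual). blinfun_apply f x) euclidean"

definition canonical :: "'a::real_normed_vector \<Rightarrow> 'a bidual" where
  "canonical x = Blinfun (\<lambda>f. blinfun_apply f x)"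

lemma canonical_apply [simp]: "blinfun_apply (canonical x) f = blinfun_apply f x"
  unfolding canonical_def
  by (simp add: bounded_linear_Blinfun_apply blinfun.bounded_linear_left)

definition eps_weakly_relatively_compact :: "real \<Rightarrow> 'a::real_normed_vector set \<Rightarrow> bool" where
  "eps_weakly_relatively_compact \<epsilon> M \<longleftrightarrow>
     0 \<le> \<epsilon> \<and> bounded M \<and>
     weak_star closure_of (canonical ` M)
       \<subseteq> {canonical x + \<epsilon> *\<^sub>R b | (x :: 'a) (b :: 'a bidual). b \<in> cball 0 1}"

text \<open>The indices range over the positive integers, since \<^term>\<open>1 / real 0 = 0\<close>.\<close>
definition property_star :: "'a::real_normed_vector itself \<Rightarrow> bool" where
  "property_star TYPE('a) \<longleftrightarrow>
     (\<exists>M :: nat \<Rightarrow> nat \<Rightarrow> 'a set.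
        (\<forall>n\<ge>1. \<forall>p\<ge>1. convex (M n p) \<and> uminus ` M n p = M n p \<and>
           eps_weakly_relatively_compact (1 / real p) (M n p)) \<and>
        (\<forall>p\<ge>1. \<forall>L. compactin weak_topology L \<longrightarrow> (\<exists>n\<ge>1. L \<subseteq> M n p)))"

definition strongly_K_sigma_delta_in :: "'t topology \<Rightarrow> 't set \<Rightarrow> bool" where
  "strongly_K_sigma_delta_in T A \<longleftrightarrow>
     A \<subseteq> topspace T \<and>
     (\<exists>K :: nat \<Rightarrow> nat \<Rightarrow> 't set.
        (\<forall>n\<ge>1. \<forall>m\<ge>1. compactin T (K n m)) \<and>
        A = (\<Inter>n\<in>{1..}. \<Union>m\<in>{1..}. K n m) \<and>
        (\<forall>L. compactin T L \<and> L \<subseteq> A \<longrightarrow> (\<forall>n\<ge>1. \<exists>m\<ge>1. L \<subseteq> K n m)))"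

definition strongly_K_sigma_delta :: "'a::real_normed_vector itself \<Rightarrow> bool" where
  "strongly_K_sigma_delta TYPE('a) \<longleftrightarrow>
     strongly_K_sigma_delta_in weak_star (range (canonical :: 'a \<Rightarrow> 'a bidual))"

end

theory Submission
  imports Defs
begin

text \<open>Index the compact sets by \<open>K\<^sub>p\<^sub>,\<^sub>n =\<close> the weak* closure of \<open>M\<^sub>n\<^sub>,\<^sub>p\<close> in the bidual; they are weak*
  compact by Banach--Alaoglu. A point of \<open>\<Inter>\<^sub>p \<Union>\<^sub>n K\<^sub>p\<^sub>,\<^sub>n\<close> has distance at most \<open>1/p\<close> from \<open>X\<close> for every
  \<open>p\<close>, so it lies in \<open>X\<close>, which is norm closed in its bidual because the canonical embedding is
  isometric (Hahn--Banach) and \<open>X\<close> is complete. Since the weak* topology induces the weak topology on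
  \<open>X\<close>, the weak* compact subsets of \<open>X\<close> are exactly its weakly compact ones.\<close>

section \<open>The Hahn--Banach theorem via minimal sublinear functionals\<close>

definition sublinear :: "('a::real_vector \<Rightarrow> real) \<Rightarrow> bool" where
  "sublinear p \<longleftrightarrow> (\<forall>x y. p (x + y) \<le> p x + p y) \<and> (\<forall>c\<ge>0. \<forall>x. p (c *\<^sub>R x) = c * p x)"

lemma sublinear_add: "sublinear p \<Longrightarrow> p (x + y) \<le> p x + p y"
  by (simp add: sublinear_def)

lemma sublinear_scale: "sublinear p \<Longrightarrow> 0 \<le> c \<Longrightarrow> p (c *\<^sub>R x) = c * p x"
  by (simp add: sublinear_def)

lemma sublinear_zero: "sublinear p \<Longrightarrow> p 0 = 0"
  using sublinear_scale[of p 0 0] by simp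

lemma sublinear_ge: "sublinear p \<Longrightarrow> - p (- x) \<le> p x"
  using sublinear_add[of p x "- x"] sublinear_zero[of p] by simp

text \<open>Scaling by \<open>inverse c\<close> reverses the inequality \<open>scale\<close>, so for
  infima only one half of homogeneity has to be checked.\<close>

lemma sublinearI:
  assumes add: "\<And>x y. p (x + y) \<le> p x + p y"
    and zero: "p 0 = 0"
    and scale: "\<And>c x. 0 < c \<Longrightarrow> p (c *\<^sub>R x) \<le> c * p x"
  shows "sublinear p"
proof -
  have "p (c *\<^sub>R x) = c * p x" if "0 < c" for c x
  proof -
    have "p x \<le> inverse c * p (c *\<^sub>R x)"
      using scale[of "inverse c" "c *\<^sub>R x"] that by simp
    then have "c * p x \<le> p (c *\<^sub>R x)"
      using that by (simp add: field_simps)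
    then show ?thesis
      using scale[OF that, of x] by simp
  qed
  then have "p (c *\<^sub>R x) = c * p x" if "0 \<le> c" for c x
    using that zero by (cases "c = 0") auto
  then show ?thesis
    using add by (auto simp: sublinear_def)
qed

text \<open>Lowers the value at \<open>- a\<close> to at most \<open>- p a\<close>, the smallest one that subadditivity permits while
  \<open>p a\<close> is kept.\<close>
definition sublinear_shift :: "('a::real_vector \<Rightarrow> real) \<Rightarrow> 'a \<Rightarrow> 'a \<Rightarrow> real" where
  "sublinear_shift p a x = (INF t\<in>{0..}. p (x + t *\<^sub>R a) - t * p a)"

text \<open>A real \<open>INF\<close> is a lower bound only for families bounded below;
  subadditivity at \<open>t *\<^sub>R a = (x + t *\<^sub>R a) + (- x)\<close> gives the bound
  \<open>- p (- x)\<close>, uniform in \<open>t\<close>.\<close>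

lemma sublinear_shift_le:
  assumes "sublinear p" "0 \<le> t"
  shows "sublinear_shift p a x \<le> p (x + t *\<^sub>R a) - t * p a"
  unfolding sublinear_shift_def
proof (rule cINF_lower)
  show "bdd_below ((\<lambda>t. p (x + t *\<^sub>R a) - t * p a) ` {0..})"
  proof (rule bdd_belowI2)
    fix t :: real assume "t \<in> {0..}"
    then show "- p (- x) \<le> p (x + t *\<^sub>R a) - t * p a"
      using sublinear_add[OF assms(1), of "x + t *\<^sub>R a" "- x"] sublinear_scale[OF assms(1), of t a]
      by simp
  qed
qed (use assms in simp)

lemma sublinear_shift_greatest:
  assumes "\<And>t. 0 \<le> t \<Longrightarrow> b \<le> p (x + t *\<^sub>R a) - t * p a"
  shows "b \<le> sublinear_shift p a x"
  unfolding sublinear_shift_def by (rule cINF_greatest) (use assms in auto)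

text \<open>Parameters \<open>s\<close> for \<open>x\<close> and \<open>t\<close> for
  \<open>y\<close> add up to \<open>s + t\<close> for \<open>x + y\<close>; scaling by
  \<open>c\<close> reparametrises \<open>t\<close> to \<open>c * t\<close>.\<close>

lemma sublinear_sublinear_shift:
  assumes p: "sublinear p"
  shows "sublinear (sublinear_shift p a)"
proof (rule sublinearI)
  fix x y
  have *: "sublinear_shift p a (x + y) \<le> (p (x + s *\<^sub>R a) - s * p a) + (p (y + t *\<^sub>R a) - t * p a)"
    if "0 \<le> s" "0 \<le> t" for s t
    using sublinear_shift_le[OF p, of "s + t" a "x + y"] that
      sublinear_add[OF p, of "x + s *\<^sub>R a" "y + t *\<^sub>R a"]
    by (simp add: algebra_simps)
  \<comment> \<open>The two infima are taken one after the other: over \<open>t\<close> with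
    \<open>s\<close> fixed, then over \<open>s\<close>.\<close>
  have "sublinear_shift p a (x + y) - (p (x + s *\<^sub>R a) - s * p a) \<le> sublinear_shift p a y"
    if "0 \<le> s" for s
    by (rule sublinear_shift_greatest) (use *[OF that] in \<open>simp add: algebra_simps\<close>)
  then have "sublinear_shift p a (x + y) - sublinear_shift p a y \<le> sublinear_shift p a x"
    by (intro sublinear_shift_greatest) (simp add: algebra_simps)
  then show "sublinear_shift p a (x + y) \<le> sublinear_shift p a x + sublinear_shift p a y"
    by simp
next
  have "0 \<le> sublinear_shift p a 0"
    by (rule sublinear_shift_greatest) (simp add: sublinear_scale[OF p])
  then show "sublinear_shift p a 0 = 0"
    using sublinear_shift_le[OF p, of 0 a 0] sublinear_zero[OF p] by simp
next
  fix c :: real and x assume c: "0 < c"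
  have "sublinear_shift p a (c *\<^sub>R x) / c \<le> sublinear_shift p a x"
  proof (rule sublinear_shift_greatest)
    fix t :: real assume t: "0 \<le> t"
    have "sublinear_shift p a (c *\<^sub>R x) \<le> p (c *\<^sub>R (x + t *\<^sub>R a)) - (c * t) * p a"
      using sublinear_shift_le[OF p, of "c * t" a "c *\<^sub>R x"] c t by (simp add: scaleR_add_right)
    then show "sublinear_shift p a (c *\<^sub>R x) / c \<le> p (x + t *\<^sub>R a) - t * p a"
      unfolding sublinear_scale[OF p less_imp_le[OF c]] using c by (simp add: field_simps)
  qed
  then show "sublinear_shift p a (c *\<^sub>R x) \<le> c * sublinear_shift p a x"
    using c by (simp add: field_simps)
qed

lemma sublinear_shift_le_self: "sublinear p \<Longrightarrow> sublinear_shift p a x \<le> p x"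
  using sublinear_shift_le[of p 0 a x] by simp

lemma sublinear_shift_uminus: "sublinear p \<Longrightarrow> sublinear_shift p a (- a) \<le> - p a"
  using sublinear_shift_le[of p 1 a "- a"] sublinear_zero[of p] by simp

text \<open>Subadditivity survives because two members \<open>q\<close>, \<open>r\<close> of a chain
  are comparable: the smaller one bounds the infimum at \<open>x + y\<close> by
  \<open>q x + r y\<close>.\<close>

lemma sublinear_INF_chain:
  assumes ne: "C \<noteq> {}" and C: "\<And>q. q \<in> C \<Longrightarrow> sublinear q"
    and bdd: "\<And>x. bdd_below ((\<lambda>q. q x) ` C)"
    and chain: "\<And>q r. q \<in> C \<Longrightarrow> r \<in> C \<Longrightarrow> q \<le> r \<or> r \<le> q"
  shows "sublinear (\<lambda>x. INF q\<in>C. q x)"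
proof (rule sublinearI)
  let ?u = "\<lambda>x. INF q\<in>C. q x"
  have le: "?u x \<le> q x" if "q \<in> C" for q x
    by (rule cINF_lower[OF bdd that])
  fix x y
  have *: "?u (x + y) \<le> q x + r y" if qr: "q \<in> C" "r \<in> C" for q r
  proof (cases "q \<le> r")
    case True
    then show ?thesis
      using le[OF qr(1), of "x + y"] sublinear_add[OF C[OF qr(1)], of x y] le_funD[OF True, of y]
      by linarith
  next
    case False
    then have "r \<le> q" using chain[OF qr] by blast
    then show ?thesis
      using le[OF qr(2), of "x + y"] sublinear_add[OF C[OF qr(2)], of x y] le_funD[OF \<open>r \<le> q\<close>, of x]
      by linarith
  qed
  have "?u (x + y) - q x \<le> ?u y" if "q \<in> C" for q
    using *[OF that] by (intro cINF_greatest[OF ne]) (simp add: algebra_simps)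
  then have "?u (x + y) - ?u y \<le> ?u x"
    by (intro cINF_greatest[OF ne]) (simp add: algebra_simps)
  then show "?u (x + y) \<le> ?u x + ?u y" by simp
next
  show "(INF q\<in>C. q 0) = 0"
    using ne C by (simp add: sublinear_zero)
next
  fix c :: real and x assume c: "0 < c"
  have "(INF q\<in>C. q (c *\<^sub>R x)) / c \<le> (INF q\<in>C. q x)"
  proof (rule cINF_greatest[OF ne])
    fix q assume q: "q \<in> C"
    have "(INF q\<in>C. q (c *\<^sub>R x)) \<le> c * q x"
      using cINF_lower[OF bdd q, of "c *\<^sub>R x"] sublinear_scale[OF C[OF q], of c x] c by simp
    then show "(INF q\<in>C. q (c *\<^sub>R x)) / c \<le> q x"
      using c by (simp add: field_simps)
  qed
  then show "(INF q\<in>C. q (c *\<^sub>R x)) \<le> c * (INF q\<in>C. q x)"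
    using c by (simp add: field_simps)
qed

lemma minimal_sublinear_exists:
  assumes p: "sublinear p"
  obtains m where "sublinear m" "m \<le> p" "\<And>q. sublinear q \<Longrightarrow> q \<le> m \<Longrightarrow> q = m"
proof -
  define A where "A = {q. sublinear q \<and> q \<le> p}"
  have "\<exists>m\<in>A. \<forall>q\<in>A. q \<le> m \<longrightarrow> q = m"
  proof (rule predicate_Zorn)
    \<comment> \<open>The order is reversed, so Zorn's lemma yields a minimal element and chains are
      bounded by pointwise infima.\<close>
    show "partial_order_on A (relation_of (\<lambda>q r. r \<le> q) A)"
      by (rule partial_order_on_relation_ofI) auto
  next
    fix C assume "C \<in> Chains (relation_of (\<lambda>q r. r \<le> q) A)"
    then have CA: "C \<subseteq> A" and chain: "\<And>q r. q \<in> C \<Longrightarrow> r \<in> C \<Longrightarrow> q \<le> r \<or> r \<le> q"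
      unfolding Chains_def relation_of_def by auto
    show "\<exists>u\<in>A. \<forall>q\<in>C. u \<le> q"
    proof (cases "C = {}")
      case True
      then show ?thesis using p by (auto simp: A_def)
    next
      case False
      have bdd: "bdd_below ((\<lambda>q. q x) ` C)" for x
      proof (rule bdd_belowI2)
        fix q assume "q \<in> C"
        then have "sublinear q" "q (- x) \<le> p (- x)"
          using CA by (auto simp: A_def le_fun_def)
        then show "- p (- x) \<le> q x"
          using sublinear_ge[of q x] by simp
      qed
      have lower: "(\<lambda>x. INF q\<in>C. q x) \<le> q" if "q \<in> C" for q
        by (rule le_funI) (rule cINF_lower[OF bdd that])
      obtain r where "r \<in> C" using False by blast
      then have "(\<lambda>x. INF q\<in>C. q x) \<le> p"
        using lower[of r] CA by (auto simp: A_def intro: order_trans)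
      moreover have "sublinear (\<lambda>x. INF q\<in>C. q x)"
        using False CA bdd chain by (intro sublinear_INF_chain) (auto simp: A_def)
      ultimately show ?thesis
        using lower unfolding A_def by blast
    qed
  qed
  then obtain m where "m \<in> A" "\<And>q. q \<in> A \<Longrightarrow> q \<le> m \<Longrightarrow> q = m" by blast
  then show ?thesis
    by (intro that[of m]) (auto simp: A_def intro: order_trans)
qed

text \<open>Minimality forces every shift of \<open>m\<close> to equal \<open>m\<close>, which makes
  \<open>m\<close> odd; subadditivity at \<open>- x\<close> and \<open>- y\<close> then becomes
  superadditivity.\<close>

lemma minimal_sublinear_linear:
  assumes m: "sublinear m" and min: "\<And>q. sublinear q \<Longrightarrow> q \<le> m \<Longrightarrow> q = m"
  shows "linear m"
proof -
  have "sublinear_shift m a = m" for a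
    using sublinear_sublinear_shift[OF m] sublinear_shift_le_self[OF m]
    by (intro min) (auto simp: le_fun_def)
  then have odd: "m (- a) = - m a" for a
    using sublinear_shift_uminus[OF m, of a] sublinear_ge[OF m, of a] by simp
  show ?thesis
  proof (rule linearI)
    fix x y
    show "m (x + y) = m x + m y"
      using sublinear_add[OF m, of x y] sublinear_add[OF m, of "- x" "- y"] odd[of "x + y"]
      by (simp add: odd)
  next
    fix c :: real and x
    show "m (c *\<^sub>R x) = c *\<^sub>R m x"
    proof (cases "0 \<le> c")
      case True
      then show ?thesis by (simp add: sublinear_scale[OF m])
    next
      case False
      then show ?thesis
        using sublinear_scale[OF m, of "- c" x] odd[of "c *\<^sub>R x"] by simp
    qed
  qed
qed

theorem hahn_banach_sublinear:
  assumes p: "sublinear p"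
  obtains f where "linear f" "\<And>x. f x \<le> p x" "f a = p a"
proof -
  \<comment> \<open>Starting below the shift instead of \<open>p\<close> forces
    \<open>f (- a) \<le> - p a\<close>, hence \<open>f a = p a\<close> once \<open>f\<close> is
    linear.\<close>
  obtain f where f: "sublinear f" "f \<le> sublinear_shift p a"
    "\<And>q. sublinear q \<Longrightarrow> q \<le> f \<Longrightarrow> q = f"
    using minimal_sublinear_exists[OF sublinear_sublinear_shift[OF p, of a]] by blast
  have lin: "linear f"
    using minimal_sublinear_linear f by blast
  have le: "f x \<le> p x" for x
    using le_funD[OF f(2), of x] sublinear_shift_le_self[OF p, of a x] by simp
  have "p a \<le> f a"
    using le_funD[OF f(2), of "- a"] sublinear_shift_uminus[OF p, of a] linear_neg[OF lin, of a]
    by simp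
  then show ?thesis
    using that[OF lin le] le[of a] by simp
qed

text \<open>The norm is itself sublinear; domination at both \<open>x\<close> and \<open>- x\<close>
  bounds the functional in absolute value.\<close>

lemma norming_functional_exists:
  fixes a :: "'a::real_normed_vector"
  obtains f :: "'a dual" where "norm f \<le> 1" "blinfun_apply f a = norm a"
proof -
  have "sublinear (norm :: 'a \<Rightarrow> real)"
    by (simp add: sublinear_def norm_triangle_ineq)
  then obtain f :: "'a \<Rightarrow> real" where f: "linear f" "\<And>x. f x \<le> norm x" "f a = norm a"
    by (rule hahn_banach_sublinear[of _ a]) blast
  have "\<bar>f x\<bar> \<le> norm x" for x
    using f(2)[of x] f(2)[of "- x"] linear_neg[OF f(1), of x] by simp
  then have bl: "bounded_linear f"
    using f(1) by (intro bounded_linear_intro[where K = 1]) (auto simp: linear_iff)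
  have "norm (Blinfun f) \<le> 1"
    using \<open>\<And>x. \<bar>f x\<bar> \<le> norm x\<close>
    by (intro norm_blinfun_bound) (auto simp: bounded_linear_Blinfun_apply[OF bl])
  then show ?thesis
    using f(3) by (intro that[of "Blinfun f"]) (auto simp: bounded_linear_Blinfun_apply[OF bl])
qed

section \<open>The canonical embedding\<close>

lemma norm_canonical [simp]: "norm (canonical x) = norm x"
proof (rule antisym)
  show "norm (canonical x) \<le> norm x"
  proof (rule norm_blinfun_bound)
    fix f :: "'a dual"
    show "norm (blinfun_apply (canonical x) f) \<le> norm x * norm f"
      using norm_blinfun[of f x] by (simp add: mult.commute)
  qed simp
  obtain f :: "'a dual" where f: "norm f \<le> 1" "blinfun_apply f x = norm x"
    by (rule norming_functional_exists)
  have "norm x \<le> norm (canonical x) * norm f"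
    using norm_blinfun[of "canonical x" f] f(2) by simp
  also have "\<dots> \<le> norm (canonical x)"
    using f(1) by (simp add: mult_left_le)
  finally show "norm x \<le> norm (canonical x)" .
qed

lemma canonical_diff: "canonical (x - y) = canonical x - canonical y"
  by (rule blinfun_eqI) (simp add: blinfun.diff_left blinfun.diff_right)

lemma dist_canonical [simp]: "dist (canonical x) (canonical y) = dist x y"
  by (simp add: dist_norm flip: canonical_diff)

lemma closed_range_canonical: "closed (range (canonical :: 'a::banach \<Rightarrow> 'a bidual))"
  unfolding closed_sequential_limits
proof (intro allI impI, elim conjE)
  fix z :: "nat \<Rightarrow> 'a bidual" and l
  assume "\<forall>n. z n \<in> range canonical" and l: "z \<longlonglongrightarrow> l"
  then obtain x where z: "z = (\<lambda>n. canonical (x n))"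
    unfolding image_iff by (metis ext)
  have "Cauchy z" using l by (rule LIMSEQ_imp_Cauchy)
  then have "Cauchy x" by (simp add: z Cauchy_def)
  then obtain y where "x \<longlonglongrightarrow> y" using Cauchy_convergent_iff convergentD by blast
  \<comment> \<open>Convergence is expressed by distances, which \<open>canonical\<close> preserves,
    and so reduces to that of \<open>x\<close>.\<close>
  then have "z \<longlonglongrightarrow> canonical y" unfolding z by (subst tendsto_dist_iff) (simp flip: tendsto_dist_iff)
  then show "l \<in> range canonical" using LIMSEQ_unique[OF l] by blast
qed

section \<open>Compactness in pullback topologies\<close>

lemma compactin_pullback_topology:
  assumes "S \<subseteq> A"
  shows "compactin (pullback_topology A f T) S \<longleftrightarrow> compactin T (f ` S)"
proof
  have "continuous_map (pullback_topology A f T) T f"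
    using continuous_map_pullback[OF continuous_map_id, of A f T] by simp
  then show "compactin T (f ` S)" if "compactin (pullback_topology A f T) S"
    using that by (rule image_compactin[rotated])
next
  assume c: "compactin T (f ` S)"
  show "compactin (pullback_topology A f T) S"
    unfolding compactin_def
  proof (intro conjI allI impI)
    show "S \<subseteq> topspace (pullback_topology A f T)"
      using c assms by (auto simp: topspace_pullback_topology compactin_def)
  next
    fix \<U> assume \<U>: "(\<forall>U\<in>\<U>. openin (pullback_topology A f T) U) \<and> S \<subseteq> \<Union> \<U>"
    then have "\<forall>U\<in>\<U>. \<exists>V. openin T V \<and> U = f -` V \<inter> A"
      by (simp add: openin_pullback_topology)
    then obtain V where V: "\<And>U. U \<in> \<U> \<Longrightarrow> openin T (V U) \<and> U = f -` V U \<inter> A"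
      by metis
    have "f ` S \<subseteq> \<Union> (V ` \<U>)"
      using \<U> V by blast
    moreover have "\<forall>W\<in>V ` \<U>. openin T W"
      using V by blast
    ultimately obtain \<F> where "finite \<F>" "\<F> \<subseteq> V ` \<U>" "f ` S \<subseteq> \<Union> \<F>"
      using c unfolding compactin_def by meson
    then obtain \<G> where \<G>: "finite \<G>" "\<G> \<subseteq> \<U>" "f ` S \<subseteq> \<Union> (V ` \<G>)"
      by (metis finite_subset_image)
    have "S \<subseteq> \<Union> \<G>"
      using \<G> V assms by blast
    then show "\<exists>\<F>. finite \<F> \<and> \<F> \<subseteq> \<U> \<and> S \<subseteq> \<Union> \<F>"
      using \<G> by blast
  qed
qed

lemma compactin_weak_star_iff: "compactin weak_star S \<longleftrightarrow> compact (blinfun_apply ` S)"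
  by (simp add: weak_star_def strong_operator_topology_def compactin_pullback_topology)

lemma compactin_weak_topology_iff:
  "compactin weak_topology L \<longleftrightarrow> compactin weak_star (canonical ` L)"
  by (simp add: weak_topology_def compactin_weak_star_iff compactin_pullback_topology image_image
      canonical_apply[abs_def])

section \<open>The Banach--Alaoglu theorem\<close>

text \<open>Linearity is a family of equations between evaluations, which are continuous for the
  product topology.\<close>

lemma closed_linear_functions: "closed {g :: 'b::real_vector \<Rightarrow> real. linear g}"
  unfolding linear_iff
  by (intro closed_Collect_conj closed_Collect_all closed_Collect_eq continuous_intros) auto

lemma image_blinfun_apply_cball:
  assumes "0 \<le> r"
  shows "blinfun_apply ` cball (0 :: 'b::real_normed_vector dual) r
    = {g. linear g} \<inter> (\<Pi>\<^sub>E x\<in>UNIV. {- (r * norm x)..r * norm x})"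
proof (intro equalityI subsetI)
  fix g :: "'b \<Rightarrow> real"
  assume "g \<in> blinfun_apply ` cball 0 r"
  then obtain f where f: "g = blinfun_apply f" "norm f \<le> r" by auto
  have "\<bar>g x\<bar> \<le> r * norm x" for x
    using norm_blinfun[of f x] mult_right_mono[OF f(2), of "norm x"] f(1) by simp
  then show "g \<in> {g. linear g} \<inter> (\<Pi>\<^sub>E x\<in>UNIV. {- (r * norm x)..r * norm x})"
    using f(1) by (auto simp: abs_le_iff minus_le_iff blinfun.bounded_linear_right bounded_linear.linear)
next
  fix g :: "'b \<Rightarrow> real"
  assume g: "g \<in> {g. linear g} \<inter> (\<Pi>\<^sub>E x\<in>UNIV. {- (r * norm x)..r * norm x})"
  then have le: "\<bar>g x\<bar> \<le> r * norm x" for x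
    by (auto simp: PiE_iff abs_le_iff minus_le_iff)
  have bl: "bounded_linear g"
    using g le by (intro bounded_linear_intro[where K = r]) (auto simp: linear_iff mult.commute)
  have "norm (Blinfun g) \<le> r"
    using le assms by (intro norm_blinfun_bound) (auto simp: bounded_linear_Blinfun_apply[OF bl])
  then show "g \<in> blinfun_apply ` cball 0 r"
    by (intro image_eqI[of _ _ "Blinfun g"]) (auto simp: bounded_linear_Blinfun_apply[OF bl])
qed

text \<open>By Tychonoff the product of the intervals is compact, and the ball is its intersection
  with the closed set of linear functions.\<close>

theorem banach_alaoglu:
  assumes "0 \<le> r"
  shows "compactin weak_star (cball (0 :: 'b::real_normed_vector dual) r)"
proof -
  have "compactin (product_topology (\<lambda>_. euclidean) UNIV)
      (\<Pi>\<^sub>E x\<in>UNIV. {- (r * norm (x :: 'b))..r * norm x})"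
    by (simp add: compactin_PiE)
  then have "compact (\<Pi>\<^sub>E x\<in>UNIV. {- (r * norm (x :: 'b))..r * norm x})"
    by (simp add: euclidean_product_topology)
  then show ?thesis
    by (simp add: compactin_weak_star_iff image_blinfun_apply_cball[OF assms]
        closed_Int_compact[OF closed_linear_functions])
qed

text \<open>For \<open>r \<ge> 0\<close> the ball is cut out by preimages of closed intervals under
  evaluations; for \<open>r < 0\<close> it is empty.\<close>

lemma closedin_weak_star_cball: "closedin weak_star (cball (0 :: 'b::real_normed_vector dual) r)"
proof (cases "0 \<le> r")
  case True
  have "cball (0 :: 'b dual) r = (\<Inter>x. {f. blinfun_apply f x \<in> {- (r * norm x)..r * norm x}})"
  proof (intro equalityI subsetI)
    fix f :: "'b dual" assume "f \<in> cball 0 r"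
    then show "f \<in> (\<Inter>x. {f. blinfun_apply f x \<in> {- (r * norm x)..r * norm x}})"
      using image_blinfun_apply_cball[OF True, where 'b = 'b] by (auto simp: PiE_iff set_eq_iff)
  next
    fix f :: "'b dual" assume "f \<in> (\<Inter>x. {f. blinfun_apply f x \<in> {- (r * norm x)..r * norm x}})"
    then have "norm f \<le> r"
      using True by (intro norm_blinfun_bound) (auto simp: abs_le_iff minus_le_iff)
    then show "f \<in> cball 0 r" by simp
  qed
  moreover have "closedin weak_star {f. blinfun_apply f x \<in> {- (r * norm x)..r * norm x}}" for x :: 'b
    using closedin_continuous_map_preimage[OF strong_operator_topology_continuous_evaluation[of x],
        of "{- (r * norm x)..r * norm x}"]
    by (simp add: weak_star_def strong_operator_topology_topspace)
  ultimately show ?thesis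
    by (auto intro!: closedin_INT)
qed simp

lemma compactin_weak_star_closure_of:
  assumes "bounded S"
  shows "compactin weak_star (weak_star closure_of S)"
proof -
  obtain r where r: "0 \<le> r" "S \<subseteq> cball 0 r"
    using assms by (metis bounded_pos less_imp_le mem_cball_0 subsetI)
  then show ?thesis
    by (intro closed_compactin[OF banach_alaoglu[OF r(1)]] closure_of_minimal closedin_weak_star_cball)
      auto
qed

section \<open>Weak* closures as the compact sets of the representation\<close>

theorem theorem3p2:
  assumes "property_star TYPE('a::banach)"
  shows "strongly_K_sigma_delta TYPE('a)"
proof -
  obtain M :: "nat \<Rightarrow> nat \<Rightarrow> 'a set" where
    erc: "\<And>n p. n \<ge> 1 \<Longrightarrow> p \<ge> 1 \<Longrightarrow> eps_weakly_relatively_compact (1 / real p) (M n p)"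
    and cover: "\<And>p L. p \<ge> 1 \<Longrightarrow> compactin weak_topology L \<Longrightarrow> \<exists>n\<ge>1. L \<subseteq> M n p"
    using assms unfolding property_star_def by metis
  \<comment> \<open>The indices of \<open>M\<close> are swapped: the intersection runs over the
    precision \<open>p\<close>, the union over \<open>n\<close>.\<close>
  define K where "K p n = weak_star closure_of (canonical ` M n p)" for p n
  have top: "topspace (weak_star :: 'a bidual topology) = UNIV"
    by (simp add: weak_star_def strong_operator_topology_topspace)
  have compact: "compactin weak_star (K p n)" if "p \<ge> 1" "n \<ge> 1" for p n
  proof -
    have "bounded (M n p)"
      using erc[OF that(2,1)] by (simp add: eps_weakly_relatively_compact_def)
    then have "bounded ((canonical :: 'a \<Rightarrow> 'a bidual) ` M n p)"
      by (simp add: bounded_iff)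
    then show ?thesis
      unfolding K_def by (rule compactin_weak_star_closure_of)
  qed
  have absorb: "\<exists>n\<ge>1. L \<subseteq> K p n"
    if L: "compactin weak_star L" "L \<subseteq> range canonical" and p: "p \<ge> 1" for L p
  proof -
    have L': "L = canonical ` (canonical -` L)"
      using L(2) by blast
    then have "compactin weak_topology (canonical -` L :: 'a set)"
      using L(1) by (simp add: compactin_weak_topology_iff)
    then obtain n where n: "n \<ge> 1" "canonical -` L \<subseteq> M n p"
      using cover[OF p] by blast
    then have "L \<subseteq> canonical ` M n p"
      using L' by blast
    also have "\<dots> \<subseteq> K p n"
      unfolding K_def by (rule closure_of_subset) (simp add: top)
    finally show ?thesis
      using n(1) by blast
  qed
  have "range canonical = (\<Inter>p\<in>{1..}. \<Union>n\<in>{1..}. K p n)"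
  proof (intro equalityI subsetI)
    fix z :: "'a bidual" assume z: "z \<in> range canonical"
    \<comment> \<open>Absorption of compact sets, applied to singletons, already puts every point of
      the space into each union.\<close>
    have "compactin weak_star {z}"
      by (simp add: top)
    then show "z \<in> (\<Inter>p\<in>{1..}. \<Union>n\<in>{1..}. K p n)"
      using absorb[of "{z}"] z by fastforce
  next
    fix z assume z: "z \<in> (\<Inter>p\<in>{1..}. \<Union>n\<in>{1..}. K p n)"
    have "\<exists>y\<in>range canonical. dist y z < e" if e: "0 < e" for e
    proof -
      \<comment> \<open>The successor keeps the index positive, as \<open>1 / real 0 = 0\<close>
        would satisfy the bound vacuously.\<close>
      obtain k where "1 / real (Suc k) < e"
        using nat_approx_posE[OF e] by blast
      then obtain p where p: "p \<ge> 1" "1 / real p < e"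
        by (intro that[of "Suc k"]) auto
      then obtain n where "n \<ge> 1" "z \<in> K p n"
        using z by fastforce
      then obtain x b where zb: "z = canonical x + (1 / real p) *\<^sub>R b" "norm b \<le> 1"
        using erc[OF _ p(1), of n] unfolding K_def eps_weakly_relatively_compact_def by auto
      have "dist (canonical x) z = (1 / real p) * norm b"
        by (simp add: zb(1) dist_norm)
      also have "\<dots> \<le> 1 / real p"
        using zb(2) by (simp add: divide_right_mono)
      finally show ?thesis
        using p(2) by (intro bexI[of _ "canonical x"]) auto
    qed
    then have "z \<in> closure (range canonical)"
      by (simp add: closure_approachable)
    then show "z \<in> range canonical"
      by (simp add: closure_closed[OF closed_range_canonical])
  qed
  then show ?thesis
    unfolding strongly_K_sigma_delta_def strongly_K_sigma_delta_in_def
    using compact absorb by (intro conjI exI[of _ K]) (auto simp: top)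
qed

end
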